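(* For all $n \ge 8$, $N_{1,3}(n) = N_{1,3}(n-2) + N_{1,3}(n-4)$. Moreover, $N_{1,3}(n) = F_{n/2}$ for every even $n \ge 4$, and $N_{1,3}(n) = 0$ for every odd $n \ge 5$, where $F_m$ denotes the $m$-th Fibonacci number with $F_0 = 0$, $F_1 = 1$.
   Context: For positive integers $a<b$ and $n \ge 3$, an $(a,b)$-necklace of length $n$ is a circular arrangement of the integers $0,1,\ldots,n-1$ (each used exactly once) such that any two adjacent entries have difference $\pm a$ or $\pm b$. Two necklaces are considered the same if one is obtained from the other by rotation or reflection. $N_{a,b}(n)$ denotes the number of distinct $(a,b)$-necklaces of length $n$; equivalently, it is the number of Hamiltonian cycles (as undirected subgraphs) of the graph on $\{0,1,\ldots,n-1\}$ in which $x,y$ are adjacent if and only if $|x-y| \in \{a,b\}$. *)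

theory Defs
  imports Main "HOL-Number_Theory.Fib"
begin

text \<open>
  A circular arrangement is represented by a list that is read cyclically, so position
  \<open>n - 1\<close> is adjacent to position \<open>0\<close>. The notions below are intended for
  \<open>0 < a < b\<close> and \<open>n \<ge> 3\<close>; outside this range their values carry no meaning.
\<close>

definition arrangements :: "nat \<Rightarrow> nat \<Rightarrow> nat \<Rightarrow> nat list set" where
  "arrangements a b n =
     {xs. distinct xs \<and> set xs = {0..<n} \<and>
          (\<forall>i<n. \<bar>int (xs ! i) - int (xs ! ((i + 1) mod n))\<bar> \<in> {int a, int b})}"

definition same_necklace :: "nat \<Rightarrow> nat \<Rightarrow> nat \<Rightarrow> (nat list \<times> nat list) set" where
  "same_necklace a b n =
     {(xs, ys). xs \<in> arrangements a b n \<and> ys \<in> arrangements a b n \<and>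
                (\<exists>k. ys = rotate k xs \<or> ys = rotate k (rev xs))}"

definition necklaces :: "nat \<Rightarrow> nat \<Rightarrow> nat \<Rightarrow> nat list set set" where
  "necklaces a b n = arrangements a b n // same_necklace a b n"

definition num_necklaces :: "nat \<Rightarrow> nat \<Rightarrow> nat \<Rightarrow> nat" where
  "num_necklaces a b n = card (necklaces a b n)"

lemma finite_arrangements: "finite (arrangements a b n)"
proof (rule finite_subset)
  show "arrangements a b n \<subseteq> {xs. set xs \<subseteq> {0..<n} \<and> length xs = n}"
    by (auto simp: arrangements_def dest: distinct_card)
  show "finite {xs. set xs \<subseteq> {0..<n} \<and> length xs = n}"
    by (rule finite_lists_length_eq) simp
qed

lemma rotate_inverse: "\<exists>m. rotate m (rotate k xs) = xs"
proof (cases "xs = []")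
  case False
  have "rotate (length xs - k mod length xs) (rotate k xs)
      = rotate (length xs - k mod length xs) (rotate (k mod length xs) xs)"
    by (metis rotate_conv_mod)
  also have "\<dots> = rotate (length xs) xs"
    using False by (simp add: rotate_rotate less_imp_le)
  finally show ?thesis by auto
qed simp

lemma rev_rotate_ex: "\<exists>m. rev (rotate k xs) = rotate m (rev xs)"
  by (metis rotate_inverse rotate_rev rev_rev_ident)

lemma equiv_same_necklace: "equiv (arrangements a b n) (same_necklace a b n)"
proof (rule equivI)
  show "same_necklace a b n \<subseteq> arrangements a b n \<times> arrangements a b n"
    by (auto simp: same_necklace_def)
  show "refl_on (arrangements a b n) (same_necklace a b n)"
    by (auto simp: refl_on_def same_necklace_def intro: exI[of _ 0])
  show "sym (same_necklace a b n)"
    unfolding sym_def same_necklace_def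
    by clarsimp (metis rotate_inverse rev_rotate_ex rev_rev_ident)
  show "trans (same_necklace a b n)"
    unfolding trans_def same_necklace_def
    by clarsimp (metis rotate_rotate rev_rotate_ex rev_rev_ident)
qed

end

theory Submission
  imports Defs
begin

text \<open>
  Every necklace can be read uniquely as a list \<open>0 # zs\<close> in which \<open>zs\<close> starts with \<open>1\<close> and
  ends with \<open>3\<close>, the only other neighbour of \<open>0\<close>. The neighbour of \<open>1\<close> in \<open>zs\<close> is \<open>2\<close> or \<open>4\<close>.
  In the first case the path \<open>0, 1, 2\<close> can be contracted to one vertex, and shifting by \<open>2\<close>
  gives such a list for \<open>n - 2\<close>. In the second case \<open>2\<close> must lie between \<open>3\<close> and \<open>5\<close>, and
  contracting \<open>4, 1, 0, 3, 2\<close> gives such a list for \<open>n - 4\<close>. Both contractions reverse the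
  orientation.
\<close>

declare One_nat_def [simp del]

section \<open>Adjacency, the symmetries of arrangements, and the paths that represent them\<close>

text \<open>The additive form avoids both integers and truncated subtraction, so concrete
  adjacencies reduce to linear arithmetic on naturals.\<close>

definition adj13 :: "nat \<Rightarrow> nat \<Rightarrow> bool" where
  "adj13 x y \<longleftrightarrow> y = x + 1 \<or> x = y + 1 \<or> y = x + 3 \<or> x = y + 3"

lemma adj13_iff: "adj13 x y \<longleftrightarrow> \<bar>int x - int y\<bar> \<in> {int 1, int 3}"
  by (auto simp: adj13_def)

lemma adj13_commute: "adj13 x y \<longleftrightarrow> adj13 y x"
  by (auto simp: adj13_def)

lemma successively_adj13_rev: "successively adj13 (rev xs) \<longleftrightarrow> successively adj13 xs"
  by (simp add: adj13_commute[symmetric] cong: successively_cong)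

lemma successively_adj13_shift:
  "successively adj13 (map (\<lambda>x. x + k) xs) \<longleftrightarrow> successively adj13 xs"
  by (simp add: successively_map adj13_def)

text \<open>Repeating the head at the end supplies the wrap-around edge, the case
  \<open>Suc i = n\<close>. Modular indexing is thereby replaced by \<open>successively\<close>,
  which splits along \<open>#\<close> and append.\<close>

lemma mem_arrangements_iff:
  assumes "n > 0"
  shows "xs \<in> arrangements 1 3 n \<longleftrightarrow>
    distinct xs \<and> set xs = {0..<n} \<and> successively adj13 (xs @ [hd xs])"
proof (cases "distinct xs \<and> set xs = {0..<n}")
  case True
  then have len: "length xs = n"
    using distinct_card[of xs] by simp
  then have ne: "xs \<noteq> []" using assms by auto
  have "(xs @ [hd xs]) ! Suc i = xs ! ((i + 1) mod n)" if "i < n" for i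
    using that len ne by (cases "Suc i = n") (auto simp: nth_append hd_conv_nth simp flip: Suc_eq_plus1)
  moreover have "(xs @ [hd xs]) ! i = xs ! i" if "i < n" for i
    using that len by (simp add: nth_append)
  ultimately have "successively adj13 (xs @ [hd xs]) \<longleftrightarrow>
      (\<forall>i<n. adj13 (xs ! i) (xs ! ((i + 1) mod n)))"
    by (simp add: successively_conv_nth len)
  then show ?thesis
    using True by (simp add: arrangements_def adj13_iff)
qed (auto simp: arrangements_def)

lemma rotate1_arrangements:
  assumes "n > 0" "xs \<in> arrangements 1 3 n"
  shows "rotate1 xs \<in> arrangements 1 3 n"
proof -
  have xs: "distinct xs" "set xs = {0..<n}" "successively adj13 (xs @ [hd xs])"
    using assms by (simp_all add: mem_arrangements_iff)
  have "successively adj13 (rotate1 xs @ [hd (rotate1 xs)])"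
  proof (cases xs)
    case (Cons x ys)
    then show ?thesis
      \<comment> \<open>Rotation moves the edge from \<open>x\<close> to \<open>hd ys\<close> from
        the front of the closed list to its end; all other edges keep their order.\<close>
      using xs(3) successively_append_iff[of adj13 "ys @ [x]" "[hd ys]"]
      by (cases ys) simp_all
  qed (use xs in simp)
  with xs(1,2) show ?thesis
    by (simp add: mem_arrangements_iff[OF assms(1)])
qed

lemma rotate_arrangements:
  assumes "n > 0" "xs \<in> arrangements 1 3 n"
  shows "rotate k xs \<in> arrangements 1 3 n"
  by (induction k) (simp_all add: assms rotate1_arrangements)

lemma rev_arrangements:
  assumes "n > 0" "xs \<in> arrangements 1 3 n"
  shows "rev xs \<in> arrangements 1 3 n"
proof -
  have xs: "distinct xs" "set xs = {0..<n}" "successively adj13 (xs @ [hd xs])"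
    using assms by (simp_all add: mem_arrangements_iff)
  then have "xs \<noteq> []" using assms(1) by auto
  then have "successively adj13 (rev xs @ [hd (rev xs)])"
    using xs(3) by (simp add: successively_append_iff successively_adj13_rev last_rev hd_rev
        adj13_commute[of "last xs"] del: successively_rev)
  with xs(1,2) show ?thesis
    by (simp add: mem_arrangements_iff[OF assms(1)])
qed

text \<open>
  For \<open>n = 2\<close> the last entry may be \<open>1\<close> itself: \<open>paths 2 = {[1]}\<close> is a degenerate 2-cycle,
  which makes the recursion and the formula valid down to the smallest cases.
\<close>

definition paths :: "nat \<Rightarrow> nat list set" where
  "paths n = {zs. zs \<noteq> [] \<and> distinct zs \<and> set zs = {1..<n} \<and> successively adj13 zs
                 \<and> hd zs = 1 \<and> adj13 (last zs) 0}"

lemma finite_paths: "finite (paths n)"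
proof (rule finite_subset)
  show "paths n \<subseteq> {xs. set xs \<subseteq> {1..<n} \<and> length xs = n - 1}"
    by (auto simp: paths_def dest: distinct_card)
  show "finite {xs. set xs \<subseteq> {1..<n} \<and> length xs = n - 1}"
    by (rule finite_lists_length_eq) simp
qed

section \<open>Extending shorter paths\<close>

text \<open>In the cycle \<open>0 # ys\<close> shifted by 2, the vertex 2 is expanded into the path
  2, 1, 0. The old head 1 becomes 3, which must come last; hence the reversal.\<close>

definition extend2 :: "nat list \<Rightarrow> nat list" where
  "extend2 ys = 1 # 2 # map (\<lambda>x. x + 2) (rev ys)"

text \<open>Here the shift is by 4 and the vertex 4 is expanded into 4, 1, 0, 3, 2; the list is read
  from 0 towards 1.\<close>

definition extend4 :: "nat list \<Rightarrow> nat list" where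
  "extend4 ys = 1 # 4 # map (\<lambda>x. x + 4) (rev ys) @ [2, 3]"

lemma adj13_0_iff: "adj13 x 0 \<longleftrightarrow> x = 1 \<or> x = 3"
  by (auto simp: adj13_def)

lemma map_add_diff:
  fixes k :: nat
  assumes "\<And>x. x \<in> set xs \<Longrightarrow> k \<le> x"
  shows "map (\<lambda>x. x + k) (map (\<lambda>x. x - k) xs) = xs"
  using assms by (auto simp: o_def intro: map_idI)

text \<open>The shifted reversal begins at 3 or 5, both neighbours of 2, and ends at 3, a neighbour
  of 0.\<close>

lemma extend2_paths:
  assumes "n \<ge> 2" "ys \<in> paths (n - 2)"
  shows "extend2 ys \<in> paths n"
proof -
  let ?us = "map (\<lambda>x. x + 2) (rev ys)"
  have ys: "ys \<noteq> []" "distinct ys" "set ys = {1..<n - 2}" "successively adj13 ys" "hd ys = 1"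
    "last ys = 1 \<or> last ys = 3"
    using assms(2) by (auto simp: paths_def adj13_0_iff)
  have "1 \<in> set ys" using ys(1,5) hd_in_set by metis
  then have "n > 3" using ys(3) by auto
  have us: "set ?us = {3..<n}"
    unfolding set_map set_rev ys(3) image_add_atLeastLessThan'
    using assms(1) by (simp del: add_2_eq_Suc')
  have "successively adj13 ?us"
    using ys(4) by (simp only: successively_adj13_shift successively_adj13_rev)
  moreover have "hd ?us = last ys + 2" "last ?us = 3"
    using ys(1,5) by (simp_all add: hd_map last_map hd_rev last_rev)
  moreover have "distinct ?us"
    using ys(2) by (simp add: distinct_map inj_on_def)
  moreover have "set (extend2 ys) = {1..<n}"
    using us \<open>n > 3\<close> unfolding extend2_def by auto
  ultimately show ?thesis
    using ys(1,6) us unfolding paths_def extend2_def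
    by (auto simp: successively_Cons adj13_def)
qed

text \<open>The shifted reversal begins at 5 or 7, both neighbours of 4, and ends at 5, a neighbour
  of 2.\<close>

lemma extend4_paths:
  assumes "n \<ge> 4" "ys \<in> paths (n - 4)"
  shows "extend4 ys \<in> paths n"
proof -
  let ?us = "map (\<lambda>x. x + 4) (rev ys)"
  have ys: "ys \<noteq> []" "distinct ys" "set ys = {1..<n - 4}" "successively adj13 ys" "hd ys = 1"
    "last ys = 1 \<or> last ys = 3"
    using assms(2) by (auto simp: paths_def adj13_0_iff)
  have "1 \<in> set ys" using ys(1,5) hd_in_set by metis
  then have "n > 5" using ys(3) by auto
  have us: "set ?us = {5..<n}"
    unfolding set_map set_rev ys(3) image_add_atLeastLessThan'
    using assms(1) by simp
  have "successively adj13 ?us"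
    using ys(4) by (simp only: successively_adj13_shift successively_adj13_rev)
  moreover have "hd ?us = last ys + 4" "last ?us = 5"
    using ys(1,5) by (simp_all add: hd_map last_map hd_rev last_rev)
  moreover have "distinct ?us"
    using ys(2) by (simp add: distinct_map inj_on_def)
  moreover have "set (extend4 ys) = {1..<n}"
    using us \<open>n > 5\<close> unfolding extend4_def by auto
  ultimately show ?thesis
    using ys(1,6) us unfolding paths_def extend4_def
    by (auto simp: successively_Cons successively_append_iff adj13_def)
qed

section \<open>Contracting longer paths\<close>

text \<open>Undoes the shift and reversal in both extensions, with \<open>k = 2\<close> and
  \<open>k = 4\<close>: the last entry \<open>k + 1\<close> becomes the head 1, and the two possible
  heads become the permitted ends 1 and 3.\<close>

lemma paths_shiftE:
  assumes "us \<noteq> []" "distinct us" "set us = {k + 1..<n}" "successively adj13 us"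
    and "last us = k + 1" "hd us = k + 1 \<or> hd us = k + 3"
  obtains ys where "ys \<in> paths (n - k)" "us = map (\<lambda>x. x + k) (rev ys)"
proof -
  have eq: "map (\<lambda>x. x + k) (map (\<lambda>x. x - k) us) = us"
    using map_add_diff[of us k] assms(3) by simp
  let ?vs = "map (\<lambda>x. x - k) us"
  have "k + 1 \<in> set us" using assms(1,5) last_in_set by metis
  then have "n > k + 1" using assms(3) by auto
  have "distinct ?vs"
    using eq assms(2) by (metis distinct_map)
  moreover have "successively adj13 ?vs"
    using eq assms(4) by (metis successively_adj13_shift)
  moreover have "set ?vs = {1..<n - k}"
  proof -
    have *: "set us = (\<lambda>x. x + k) ` {1..<n - k}"
      using assms(3) image_add_atLeastLessThan'[of k 1 "n - k"] \<open>n > k + 1\<close>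
      by (simp add: add.commute)
    show ?thesis unfolding set_map * image_image by simp
  qed
  ultimately have "rev ?vs \<in> paths (n - k)"
    using assms(1,5,6)
    by (auto simp: paths_def successively_adj13_rev hd_rev last_rev hd_map last_map adj13_0_iff
        simp del: successively_rev)
  then show thesis
    using that eq by (metis rev_rev_ident)
qed

lemma distinct_last_eq_hd:
  assumes "distinct xs" "xs \<noteq> []" "last xs = hd xs"
  shows "xs = [hd xs]"
  using assms last_in_set[of "tl xs"]
  by (cases xs) (auto simp del: last_in_set split: if_splits)

lemma paths_cases:
  assumes n: "n \<ge> 4" and zs: "zs \<in> paths n"
  shows "zs \<in> extend2 ` paths (n - 2) \<union> extend4 ` paths (n - 4)"
proof -
  have z: "distinct zs" "set zs = {1..<n}" "successively adj13 zs" "hd zs = 1" "zs \<noteq> []"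
    "last zs = 1 \<or> last zs = 3"
    using zs by (auto simp: paths_def adj13_0_iff)
  have "length zs = n - 1"
    using z distinct_card[of zs] by simp
  with n z(4) obtain a b us where abus: "zs = 1 # a # b # us"
    by (cases zs; cases "tl zs"; cases "tl (tl zs)") auto
  define ws where "ws = b # us"
  have zs_eq: "zs = 1 # a # ws" and ws: "ws \<noteq> []"
    by (simp_all add: abus ws_def)
  \<comment> \<open>The other candidate, 1, is already the head of \<open>zs\<close>.\<close>
  have last: "last ws = 3"
    using z(1,6) ws last_in_set[OF ws] unfolding zs_eq by (auto simp del: last_in_set)
  have "a \<noteq> 0" "a \<noteq> 1" "adj13 1 a"
    using z(1-3) unfolding zs_eq by auto
  then consider "a = 2" | "a = 4" by (auto simp: adj13_def)
  then show ?thesis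
  proof cases
    case 1
    have "set ws = set zs - {1, 2}"
      using z(1) unfolding zs_eq 1 by auto
    also have "\<dots> = {2 + 1..<n}" unfolding z(2) by auto
    finally have set_ws: "set ws = {2 + 1..<n}" .
    have "adj13 2 (hd ws)"
      using z(3) ws unfolding zs_eq 1 by (auto simp: successively_Cons)
    moreover have "hd ws \<ge> 3" using hd_in_set[OF ws] set_ws by auto
    ultimately have "hd ws = 2 + 1 \<or> hd ws = 2 + 3" by (auto simp: adj13_def)
    moreover have "distinct ws" "successively adj13 ws"
      using z(1,3) unfolding zs_eq by (auto simp: successively_Cons)
    moreover have "last ws = 2 + 1" using last by simp
    ultimately obtain ys where ys: "ys \<in> paths (n - 2)" "ws = map (\<lambda>x. x + 2) (rev ys)"
      using paths_shiftE[OF ws _ set_ws] by metis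
    have "zs = extend2 ys" unfolding zs_eq 1 extend2_def ys(2) ..
    then show ?thesis using ys(1) by blast
  next
    case 2
    have "2 \<in> set zs" using z(2) n by auto
    then have "2 \<in> set ws" unfolding zs_eq 2 by simp
    then obtain us vs where uv: "ws = us @ 2 # vs" by (meson split_list)
    have d: "distinct (1 # 4 # us @ 2 # vs)" and s: "successively adj13 (1 # 4 # us @ 2 # vs)"
      using z(1,3) unfolding zs_eq 2 uv by simp_all
    have vs: "vs \<noteq> []" "last vs = 3" using last uv by (auto split: if_splits)
    then have "3 \<in> set vs" using last_in_set by metis
    \<comment> \<open>Otherwise 4 and 2 would be consecutive, but they differ by 2.\<close>
    have us: "us \<noteq> []" using s by (auto simp: adj13_def)
    have "adj13 (last us) 2" "adj13 2 (hd vs)" "adj13 4 (hd us)"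
      using s us vs(1) by (auto simp: successively_Cons successively_append_iff)
    moreover have "last us \<in> set us" "hd vs \<in> set vs" using us vs(1) by simp_all
    \<comment> \<open>The neighbours of 2 in \<open>zs\<close> can only be 1, 3 and 5. Since 1 is
      used at the front and 3 lies in \<open>vs\<close>, the predecessor of 2 is 5, which leaves 3
      as its successor.\<close>
    moreover have "last us \<noteq> 1" "last us \<noteq> 3" "hd vs \<noteq> 1" "last us \<noteq> hd vs"
      using d \<open>3 \<in> set vs\<close> \<open>last us \<in> set us\<close> \<open>hd vs \<in> set vs\<close> by auto
    ultimately have "last us = 5" "hd vs = 3"
      by (auto simp: adj13_def)
    \<comment> \<open>\<open>vs\<close> both begins and ends with 3, so distinctness leaves a single
      entry.\<close>
    then have vs3: "vs = [3]"
      using vs d distinct_last_eq_hd[of vs] by simp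
    have "set us = set zs - {1, 4, 2, 3}"
      using d unfolding zs_eq 2 uv vs3 by auto
    also have "\<dots> = {4 + 1..<n}" unfolding z(2) by auto
    finally have set_us: "set us = {4 + 1..<n}" .
    have "hd us \<ge> 5" using hd_in_set[OF us] set_us by auto
    with \<open>adj13 4 (hd us)\<close> have "hd us = 4 + 1 \<or> hd us = 4 + 3" by (auto simp: adj13_def)
    moreover have "distinct us" "successively adj13 us"
      using d s by (auto simp: successively_Cons successively_append_iff)
    moreover have "last us = 4 + 1" using \<open>last us = 5\<close> by simp
    ultimately obtain ys where ys: "ys \<in> paths (n - 4)" "us = map (\<lambda>x. x + 4) (rev ys)"
      using paths_shiftE[OF us _ set_us] by metis
    have "zs = extend4 ys" unfolding zs_eq 2 uv vs3 extend4_def ys(2) ..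
    then show ?thesis using ys(1) by blast
  qed
qed

section \<open>Counting paths\<close>

text \<open>The images of the two injective extensions partition \<open>paths n\<close>; the second
  entry, 2 or 4, tells them apart.\<close>

lemma card_paths_rec:
  assumes "n \<ge> 4"
  shows "card (paths n) = card (paths (n - 2)) + card (paths (n - 4))"
proof -
  have "paths n = extend2 ` paths (n - 2) \<union> extend4 ` paths (n - 4)"
    using paths_cases[OF assms] extend2_paths[of n] extend4_paths[of n] assms by auto
  moreover have "extend2 ` paths (n - 2) \<inter> extend4 ` paths (n - 4) = {}"
    by (auto simp: extend2_def extend4_def)
  moreover have "inj_on extend2 A" "inj_on extend4 A" for A
    by (auto simp: inj_on_def extend2_def extend4_def inj_map_eq_map)
  ultimately show ?thesis
    by (simp add: card_Un_disjoint finite_paths card_image)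
qed

lemma card_paths: "card (paths n) = (if even n then fib (n div 2) else 0)"
proof (induction n rule: less_induct)
  case (less n)
  consider "n \<le> 1" | "n = 2" | "n = 3" | "n \<ge> 4" by linarith
  then show ?case
  proof cases
    case 1
    then have "paths n = {}" by (auto simp: paths_def)
    with 1 show ?thesis by (cases n) auto
  next
    case 2
    have "zs = [1]" if "distinct zs" "set zs = {1}" for zs :: "nat list"
      using that by (cases zs; cases "tl zs") auto
    moreover have "{1..<2} = {1::nat}" by auto
    ultimately have "paths 2 = {[1]}" by (auto simp: paths_def adj13_def)
    with 2 show ?thesis by simp
  next
    case 3
    \<comment> \<open>The entry 3 is out of range, so the path would have to end at its head 1,
      leaving no place for 2.\<close>
    have False if zs: "zs \<in> paths 3" for zs
    proof -
      have *: "zs \<noteq> []" "distinct zs" "set zs = {1..<3}" "hd zs = 1" "last zs = 1 \<or> last zs = 3"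
        using zs by (auto simp: paths_def adj13_0_iff)
      have "last zs < 3" using last_in_set[OF *(1)] *(3) by auto
      then have "last zs = hd zs" using * by auto
      then have "zs = [1]" using distinct_last_eq_hd[of zs] *(1,2,4) by simp
      moreover have "2 \<in> set zs" using *(3) by auto
      ultimately show False by simp
    qed
    then have "paths n = {}" using 3 by auto
    then show ?thesis using 3 by simp
  next
    case 4
    then obtain m where m: "n = m + 4"
      using le_Suc_ex[of 4 n] by (metis add.commute)
    have "(m + 2) div 2 = Suc (m div 2)" "(m + 4) div 2 = Suc (Suc (m div 2))"
      by simp_all
    then show ?thesis
      using card_paths_rec[OF 4] less.IH[of "m + 2"] less.IH[of m] by (simp add: m)
  qed
qed

section \<open>Paths as unique representatives of necklaces\<close>

lemma Cons_0_arrangements: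
  assumes "n \<ge> 2" "zs \<in> paths n"
  shows "0 # zs \<in> arrangements 1 3 n"
proof -
  have zs: "zs \<noteq> []" "distinct zs" "set zs = {1..<n}" "successively adj13 zs" "hd zs = 1"
    "adj13 (last zs) 0"
    using assms(2) by (simp_all add: paths_def)
  have "set (0 # zs) = {0..<n}"
    unfolding list.set(2) zs(3) using assms(1) by auto
  moreover have "successively adj13 (0 # zs @ [0])"
    using zs by (simp add: successively_Cons successively_append_iff adj13_def)
  ultimately show ?thesis
    using zs(2,3) assms(1) by (simp add: mem_arrangements_iff)
qed

text \<open>Rotation brings 0 to the front; a reflection, if necessary, then makes 1 rather than 3
  its successor.\<close>

lemma necklaces_eq:
  assumes n: "n \<ge> 4"
  shows "necklaces 1 3 n = (\<lambda>zs. same_necklace 1 3 n `` {0 # zs}) ` paths n"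
proof (intro equalityI subsetI)
  fix X assume "X \<in> necklaces 1 3 n"
  then obtain xs where xs: "xs \<in> arrangements 1 3 n" and X: "X = same_necklace 1 3 n `` {xs}"
    unfolding necklaces_def by (auto elim: quotientE)
  have n0: "n > 0" using n by simp
  have "0 \<in> set xs" using xs n by (auto simp: arrangements_def)
  then obtain us vs where "xs = us @ 0 # vs" by (meson split_list)
  define zs where "zs = vs @ us"
  have rot: "rotate (length us) xs = 0 # zs"
    by (simp add: \<open>xs = us @ 0 # vs\<close> zs_def rotate_append)
  then have arr: "0 # zs \<in> arrangements 1 3 n"
    using rotate_arrangements[OF n0 xs] by metis
  then have d: "distinct (0 # zs)" "set (0 # zs) = {0..<n}" "successively adj13 (0 # zs @ [0])"
    using n0 by (auto simp: mem_arrangements_iff)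
  have "length (0 # zs) = n" using distinct_card[OF d(1)] d(2) by simp
  then have ne: "zs \<noteq> []" "tl zs \<noteq> []" using n by (cases zs; cases "tl zs"; simp)+
  have "set zs = set (0 # zs) - {0}" using d(1) by simp
  also have "\<dots> = {1..<n}" unfolding d(2) by auto
  finally have set_zs: "set zs = {1..<n}" .
  have ends: "successively adj13 zs" "adj13 (hd zs) 0" "adj13 (last zs) 0"
    using d(3) ne by (auto simp: successively_Cons successively_append_iff adj13_commute)
  \<comment> \<open>As \<open>zs\<close> has at least two entries, the neighbours of 0 are distinct,
    hence 1 and 3 in some order.\<close>
  have neq: "hd zs \<noteq> last zs"
    using ne d(1) by (cases zs) auto
  have same: "(xs, 0 # zs) \<in> same_necklace 1 3 n"
    using xs arr rot by (auto simp: same_necklace_def intro: exI[of _ "length us"])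
  show "X \<in> (\<lambda>zs. same_necklace 1 3 n `` {0 # zs}) ` paths n"
  proof (cases "hd zs = 1")
    case True
    then have "zs \<in> paths n"
      using d(1) ne ends set_zs by (simp add: paths_def)
    moreover have "X = same_necklace 1 3 n `` {0 # zs}"
      unfolding X using equiv_class_eq[OF equiv_same_necklace same] .
    ultimately show ?thesis by blast
  next
    case False
    then have "last zs = 1" using ends neq by (auto simp: adj13_0_iff)
    then have "rev zs \<in> paths n"
      using d(1) ne ends set_zs
      by (simp add: paths_def successively_adj13_rev hd_rev last_rev del: successively_rev)
    \<comment> \<open>Reversal sends 0 to the end; this rotation returns it to the front.\<close>
    moreover have "rotate (length zs) (rev (0 # zs)) = 0 # rev zs"
      using rotate_append[of "rev zs" "[0]"] by simp
    then have "(0 # zs, 0 # rev zs) \<in> same_necklace 1 3 n"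
      using arr Cons_0_arrangements[OF _ \<open>rev zs \<in> paths n\<close>] n
      unfolding same_necklace_def by (simp del: rev.simps) metis
    then have "X = same_necklace 1 3 n `` {0 # rev zs}"
      unfolding X using equiv_class_eq[OF equiv_same_necklace] same by metis
    ultimately show ?thesis by blast
  qed
next
  fix X assume "X \<in> (\<lambda>zs. same_necklace 1 3 n `` {0 # zs}) ` paths n"
  then show "X \<in> necklaces 1 3 n"
    using Cons_0_arrangements n unfolding necklaces_def by (auto intro: quotientI)
qed

text \<open>In a distinct list the head determines the offset modulo the length.\<close>

lemma rotate_eq_if_hd_eq:
  assumes "distinct xs" "hd (rotate k xs) = hd xs"
  shows "rotate k xs = xs"
proof (cases "xs = []")
  case False
  then have "xs ! (k mod length xs) = xs ! 0"
    using assms(2) by (simp only: hd_rotate_conv_nth hd_conv_nth[of xs] not_False_eq_True)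
  then have "k mod length xs = 0"
    using assms(1) False by (simp add: nth_eq_iff_index_eq)
  then show ?thesis
    by (metis rotate_conv_mod rotate0 id_apply)
qed simp

text \<open>Both representatives begin with 0, so a rotation between them is trivial. A reflection
  would give \<open>ws = rev zs\<close>, putting 1 at both ends of \<open>zs\<close>, which is
  impossible for this \<open>n\<close>.\<close>

lemma inj_on_necklace:
  assumes n: "n \<ge> 4"
  shows "inj_on (\<lambda>zs. same_necklace 1 3 n `` {0 # zs}) (paths n)"
proof (rule inj_onI)
  fix zs ws
  assume zs: "zs \<in> paths n" and ws: "ws \<in> paths n"
    and eq: "same_necklace 1 3 n `` {0 # zs} = same_necklace 1 3 n `` {0 # ws}"
  have z: "distinct (0 # zs)" "zs \<noteq> []" "hd zs = 1"
    using zs by (auto simp: paths_def)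
  have "0 # ws \<in> arrangements 1 3 n"
    using Cons_0_arrangements[OF _ ws] n by simp
  from eq_equiv_class[OF eq equiv_same_necklace this]
  obtain k where "0 # ws = rotate k (0 # zs) \<or> 0 # ws = rotate k (rev (0 # zs))"
    by (auto simp: same_necklace_def)
  then show "zs = ws"
  proof
    assume "0 # ws = rotate k (0 # zs)"
    then show ?thesis
      using rotate_eq_if_hd_eq[OF z(1), of k] by (metis list.sel(1) list.inject)
  next
    assume *: "0 # ws = rotate k (rev (0 # zs))"
    \<comment> \<open>Absorbing one rotation yields a list that begins with 0, so that the heads
      agree.\<close>
    have "rev (0 # zs) = rotate 1 (0 # rev zs)" by (simp add: One_nat_def)
    with * have *: "0 # ws = rotate (k + 1) (0 # rev zs)"
      by (metis rotate_rotate)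
    moreover have "distinct (0 # rev zs)" using z(1) by simp
    ultimately have "ws = rev zs"
      using rotate_eq_if_hd_eq[of "0 # rev zs" "k + 1"] by (metis list.sel(1) list.inject)
    then have "last zs = 1" using ws z(2) by (simp add: paths_def hd_rev)
    then have "zs = [1]"
      using z distinct_last_eq_hd[of zs] by simp
    moreover have "set zs = {1..<n}" using zs by (simp add: paths_def)
    moreover have "2 \<in> {1..<n}" using n by simp
    ultimately show ?thesis
      by (metis empty_iff empty_set numeral_One numeral_eq_iff semiring_norm(85) set_ConsD)
  qed
qed

lemma num_necklaces_1_3:
  assumes "n \<ge> 4"
  shows "num_necklaces 1 3 n = (if even n then fib (n div 2) else 0)"
  using assms
  by (simp add: num_necklaces_def necklaces_eq card_image inj_on_necklace card_paths)

theorem mainTheorem4: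
  shows "(\<forall>n::nat. n \<ge> 8 \<longrightarrow>
            num_necklaces 1 3 n = num_necklaces 1 3 (n - 2) + num_necklaces 1 3 (n - 4))
       \<and> (\<forall>n::nat. n \<ge> 4 \<and> even n \<longrightarrow> num_necklaces 1 3 n = fib (n div 2))
       \<and> (\<forall>n::nat. n \<ge> 5 \<and> odd n \<longrightarrow> num_necklaces 1 3 n = 0)"
proof (intro conjI allI impI)
  fix n :: nat
  assume "n \<ge> 8"
  then show "num_necklaces 1 3 n = num_necklaces 1 3 (n - 2) + num_necklaces 1 3 (n - 4)"
    \<comment> \<open>The bound 8 keeps \<open>n - 4\<close> at least 4, so all three necklace
      counts are path counts.\<close>
    using card_paths_rec[of n] by (simp add: num_necklaces_1_3 card_paths)
qed (simp_all add: num_necklaces_1_3)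

end
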